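(* Let $\mathcal R$ be an expansion of the ordered field of real numbers $(\mathbb{R},<,+,\cdot)$. The following are equivalent: (i) $\mathcal R$ is i-minimal, that is, every subset of $\mathbb{R}$ definable in $\mathcal R$ either has nonempty interior or is nowhere dense; (ii) every subset of $\mathbb{R}$ definable in $\mathcal R$ either has nonempty interior or has Lebesgue measure $0$; (iii) every subset of $\mathbb{R}$ definable in $\mathcal R$ either has nonempty interior or has Hausdorff dimension $0$.
   Context: "Definable" means definable in the first-order structure $\mathcal R$ with parameters from $\mathbb{R}$. *)

theory Defs
  imports "HOL-Analysis.Analysis"
begin

text \<open>One-sorted first-order logic with equality. A language has all elements of \<^typ>\<open>'f\<close> as
  function symbols and all elements of \<^typ>\<open>'r\<close> as relation symbols; arities are part of the
  structure, and constants are function symbols of arity 0. The universe of a structure is the whole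
  type \<^typ>\<open>'a\<close>. Interpretations are only ever consulted on argument lists of the correct length,
  because definability below refers to well-formed formulas only.\<close>

datatype 'f fo_term = Var nat | Fun 'f "'f fo_term list"

datatype ('f, 'r) fo_formula =
    Eq "'f fo_term" "'f fo_term"
  | Rel 'r "'f fo_term list"
  | Neg "('f, 'r) fo_formula"
  | Conj "('f, 'r) fo_formula" "('f, 'r) fo_formula"
  | Ex nat "('f, 'r) fo_formula"

record ('f, 'r, 'a) fo_structure =
  fun_arity :: "'f \<Rightarrow> nat"
  rel_arity :: "'r \<Rightarrow> nat"
  fun_interp :: "'f \<Rightarrow> 'a list \<Rightarrow> 'a"
  rel_interp :: "'r \<Rightarrow> 'a list \<Rightarrow> bool"

primrec wf_term :: "('f, 'r, 'a) fo_structure \<Rightarrow> 'f fo_term \<Rightarrow> bool" where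
  "wf_term M (Var n) \<longleftrightarrow> True"
| "wf_term M (Fun f ts) \<longleftrightarrow> length ts = fun_arity M f \<and> list_all (wf_term M) ts"

primrec wf_formula :: "('f, 'r, 'a) fo_structure \<Rightarrow> ('f, 'r) fo_formula \<Rightarrow> bool" where
  "wf_formula M (Eq s t) \<longleftrightarrow> wf_term M s \<and> wf_term M t"
| "wf_formula M (Rel r ts) \<longleftrightarrow> length ts = rel_arity M r \<and> list_all (wf_term M) ts"
| "wf_formula M (Neg \<phi>) \<longleftrightarrow> wf_formula M \<phi>"
| "wf_formula M (Conj \<phi> \<psi>) \<longleftrightarrow> wf_formula M \<phi> \<and> wf_formula M \<psi>"
| "wf_formula M (Ex n \<phi>) \<longleftrightarrow> wf_formula M \<phi>"

primrec term_val :: "('f, 'r, 'a) fo_structure \<Rightarrow> (nat \<Rightarrow> 'a) \<Rightarrow> 'f fo_term \<Rightarrow> 'a" where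
  "term_val M v (Var n) = v n"
| "term_val M v (Fun f ts) = fun_interp M f (map (term_val M v) ts)"

primrec sat :: "('f, 'r, 'a) fo_structure \<Rightarrow> (nat \<Rightarrow> 'a) \<Rightarrow> ('f, 'r) fo_formula \<Rightarrow> bool" where
  "sat M v (Eq s t) \<longleftrightarrow> term_val M v s = term_val M v t"
| "sat M v (Rel r ts) \<longleftrightarrow> rel_interp M r (map (term_val M v) ts)"
| "sat M v (Neg \<phi>) \<longleftrightarrow> \<not> sat M v \<phi>"
| "sat M v (Conj \<phi> \<psi>) \<longleftrightarrow> sat M v \<phi> \<and> sat M v \<psi>"
| "sat M v (Ex n \<phi>) \<longleftrightarrow> (\<exists>a. sat M (v(n := a)) \<phi>)"

text \<open>Definability of subsets of the universe, with parameters: variable 0 is the free variable,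
  and the assignment \<open>v\<close> supplies the parameters for the remaining free variables.\<close>

definition definable :: "('f, 'r, 'a) fo_structure \<Rightarrow> 'a set \<Rightarrow> bool" where
  "definable M S \<longleftrightarrow> (\<exists>\<phi> v. wf_formula M \<phi> \<and> S = {x. sat M (v(0 := x)) \<phi>})"

definition expands_real_field :: "('f, 'r, real) fo_structure \<Rightarrow> bool" where
  "expands_real_field M \<longleftrightarrow>
     (\<exists>l. rel_arity M l = 2 \<and> (\<forall>x y. rel_interp M l [x, y] \<longleftrightarrow> x < y)) \<and>
     (\<exists>p. fun_arity M p = 2 \<and> (\<forall>x y. fun_interp M p [x, y] = x + y)) \<and>
     (\<exists>t. fun_arity M t = 2 \<and> (\<forall>x y. fun_interp M t [x, y] = x * y))"

definition nowhere_dense :: "'a::topological_space set \<Rightarrow> bool" where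
  "nowhere_dense S \<longleftrightarrow> interior (closure S) = {}"

definition i_minimal :: "('f, 'r, real) fo_structure \<Rightarrow> bool" where
  "i_minimal M \<longleftrightarrow> (\<forall>S. definable M S \<longrightarrow> interior S \<noteq> {} \<or> nowhere_dense S)"

text \<open>The \<open>s\<close>-th power of the diameter, with the convention that for \<open>s = 0\<close> a nonempty set
  contributes 1 (note that \<open>0 powr 0 = 0\<close>) and the empty set always contributes 0.\<close>

definition diam_power :: "real \<Rightarrow> 'a::metric_space set \<Rightarrow> ennreal" where
  "diam_power s U = (if U = {} then 0 else if s = 0 then 1 else ennreal (diameter U powr s))"

text \<open>Boundedness is required explicitly because \<^const>\<open>diameter\<close> is real-valued and
  unspecified on unbounded sets.\<close>

definition hausdorff_premeasure :: "real \<Rightarrow> real \<Rightarrow> 'a::metric_space set \<Rightarrow> ennreal" where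
  "hausdorff_premeasure s \<delta> A =
     (INF U \<in> {U :: nat \<Rightarrow> 'a set. A \<subseteq> (\<Union>i. U i) \<and> (\<forall>i. bounded (U i) \<and> diameter (U i) \<le> \<delta>)}.
        \<Sum>i. diam_power s (U i))"

definition hausdorff_measure :: "real \<Rightarrow> 'a::metric_space set \<Rightarrow> ennreal" where
  "hausdorff_measure s A = (SUP \<delta> \<in> {0<..}. hausdorff_premeasure s \<delta> A)"

text \<open>The empty set has dimension 0 under this definition.\<close>

definition hausdorff_dim :: "'a::metric_space set \<Rightarrow> ennreal" where
  "hausdorff_dim A = Inf {ennreal s | s. 0 \<le> s \<and> hausdorff_measure s A = 0}"

end

theory Submission
  imports Defs
begin

text \<open>If a definable set and its complement in an interval both had empty interior, they would
  both be null; and sets of Hausdorff dimension 0 are null. The substantial step starts from an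
  i-minimal structure and a bounded definable set \<open>S\<close> without interior. The right endpoints of
  the gaps of \<open>S\<close> form a countable definable set \<open>D\<close> whose closure contains \<open>S\<close>. Definable images
  of \<open>D\<close> are again countable, hence nowhere dense. In particular some \<open>t\<close> lies at positive distance
  from all quotients \<open>(a - b) / (c - d)\<close> of differences from \<open>D\<close>, so that \<open>(a, b) \<mapsto> a - t b\<close>
  maps \<open>r\<close>-separated subsets of \<open>D \<times> D\<close> injectively to \<open>e r\<close>-separated subsets of a bounded
  countable definable set. Iterating \<open>k\<close> times shows that \<open>r\<close>-separated subsets of \<open>D\<close> have at
  most \<open>(C / r) powr (1 / 2 ^ k)\<close> elements.\<close>

section \<open>Definability\<close>

primrec rename_term :: "(nat \<Rightarrow> nat) \<Rightarrow> 'f fo_term \<Rightarrow> 'f fo_term" where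
  "rename_term f (Var n) = Var (f n)"
| "rename_term f (Fun g ts) = Fun g (map (rename_term f) ts)"

primrec rename_formula :: "(nat \<Rightarrow> nat) \<Rightarrow> ('f, 'r) fo_formula \<Rightarrow> ('f, 'r) fo_formula" where
  "rename_formula f (Eq s t) = Eq (rename_term f s) (rename_term f t)"
| "rename_formula f (Rel r ts) = Rel r (map (rename_term f) ts)"
| "rename_formula f (Neg \<phi>) = Neg (rename_formula f \<phi>)"
| "rename_formula f (Conj \<phi> \<psi>) = Conj (rename_formula f \<phi>) (rename_formula f \<psi>)"
| "rename_formula f (Ex n \<phi>) = Ex (f n) (rename_formula f \<phi>)"

lemma wf_rename_term [simp]: "wf_term M (rename_term f t) = wf_term M t"
  by (induction t) (auto simp: list_all_iff)

lemma wf_rename_formula [simp]: "wf_formula M (rename_formula f \<phi>) = wf_formula M \<phi>"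
  by (induction \<phi>) (auto simp: list_all_iff)

lemma term_val_rename [simp]: "term_val M v (rename_term f t) = term_val M (v \<circ> f) t"
  by (induction t) (auto intro!: arg_cong[where f = "fun_interp M _"])

text \<open>Bound variables are renamed along with the free ones. Injectivity rules out capture:
  assigning to \<open>f n\<close> changes no other \<open>f m\<close>.\<close>

lemma sat_rename:
  assumes "inj f"
  shows "sat M v (rename_formula f \<phi>) = sat M (v \<circ> f) \<phi>"
proof (induction \<phi> arbitrary: v)
  case (Rel r ts)
  then show ?case by (auto intro!: arg_cong[where f = "rel_interp M r"] simp: comp_def)
next
  case (Ex n \<phi>)
  have "v(f n := a) \<circ> f = (v \<circ> f)(n := a)" for a
    using assms by (auto simp: fun_eq_iff inj_eq)
  then show ?case by (simp only: rename_formula.simps sat.simps Ex)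
qed auto

section \<open>Predicates and terms definable with parameters\<close>

definition interleave :: "(nat \<Rightarrow> 'a) \<Rightarrow> (nat \<Rightarrow> 'a) \<Rightarrow> nat \<Rightarrow> 'a" where
  "interleave u w i = (if even i then u (i div 2) else w (i div 2))"

text \<open>Free variables sit at even positions and parameters at odd ones, so the parameters of
  finitely many predicates can always be renamed apart.\<close>

definition definable_pred :: "('f, 'r, 'a) fo_structure \<Rightarrow> ((nat \<Rightarrow> 'a) \<Rightarrow> bool) \<Rightarrow> bool" where
  "definable_pred M P \<longleftrightarrow> (\<exists>\<phi> w. wf_formula M \<phi> \<and> (\<forall>u. P u \<longleftrightarrow> sat M (interleave u w) \<phi>))"

definition definable_term :: "('f, 'r, 'a) fo_structure \<Rightarrow> ((nat \<Rightarrow> 'a) \<Rightarrow> 'a) \<Rightarrow> bool" where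
  "definable_term M F \<longleftrightarrow> (\<exists>t w. wf_term M t \<and> (\<forall>u. F u = term_val M (interleave u w) t))"

text \<open>Free variables stay put. Parameter \<open>j\<close> moves from position
  \<open>2 * j + 1\<close> to \<open>4 * j + 1\<close>, and under \<open>right_pos\<close> to
  \<open>4 * j + 3\<close>; there \<open>interleave u (interleave w w')\<close> holds
  \<open>w j\<close> and \<open>w' j\<close>.\<close>

definition left_pos :: "nat \<Rightarrow> nat" where
  "left_pos i = (if even i then i else 2 * i - 1)"

definition right_pos :: "nat \<Rightarrow> nat" where
  "right_pos i = (if even i then i else 2 * i + 1)"

lemma inj_left_pos: "inj left_pos"
  by (rule injI) (auto simp: left_pos_def split: if_splits elim!: oddE)

lemma inj_right_pos: "inj right_pos"
  by (rule injI) (auto simp: right_pos_def split: if_splits)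

lemma interleave_left_pos: "interleave u (interleave w w') \<circ> left_pos = interleave u w"
  by (auto simp: fun_eq_iff interleave_def left_pos_def elim!: oddE)
    (metis dvd_triv_left even_Suc)+

lemma interleave_right_pos: "interleave u (interleave w w') \<circ> right_pos = interleave u w'"
  by (auto simp: fun_eq_iff interleave_def right_pos_def elim!: oddE; presburger)

lemma interleave_upd: "interleave (u(n := a)) w = (interleave u w)(2 * n := a)"
  by (auto simp: fun_eq_iff interleave_def)

lemma definable_pred_not: "definable_pred M P \<Longrightarrow> definable_pred M (\<lambda>u. \<not> P u)"
  unfolding definable_pred_def by (metis sat.simps(3) wf_formula.simps(3))

lemma definable_pred_conj:
  assumes "definable_pred M P" "definable_pred M Q"
  shows "definable_pred M (\<lambda>u. P u \<and> Q u)"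
proof -
  obtain \<phi> w \<psi> w' where "wf_formula M \<phi>" "\<And>u. P u \<longleftrightarrow> sat M (interleave u w) \<phi>"
    "wf_formula M \<psi>" "\<And>u. Q u \<longleftrightarrow> sat M (interleave u w') \<psi>"
    using assms unfolding definable_pred_def by blast
  then show ?thesis unfolding definable_pred_def
    by (intro exI[of _ "Conj (rename_formula left_pos \<phi>) (rename_formula right_pos \<psi>)"]
        exI[of _ "interleave w w'"])
      (simp add: sat_rename inj_left_pos inj_right_pos interleave_left_pos interleave_right_pos)
qed

lemma definable_pred_imp:
  assumes "definable_pred M P" "definable_pred M Q"
  shows "definable_pred M (\<lambda>u. P u \<longrightarrow> Q u)"
  using definable_pred_not[OF definable_pred_conj[OF assms(1) definable_pred_not[OF assms(2)]]]
  by simp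

lemma definable_pred_ex:
  assumes "definable_pred M P"
  shows "definable_pred M (\<lambda>u. \<exists>a. P (u(n := a)))"
proof -
  obtain \<phi> w where "wf_formula M \<phi>" "\<And>u. P u \<longleftrightarrow> sat M (interleave u w) \<phi>"
    using assms unfolding definable_pred_def by blast
  then show ?thesis unfolding definable_pred_def
    by (intro exI[of _ "Ex (2 * n) \<phi>"] exI[of _ w]) (simp add: interleave_upd)
qed

lemma definable_pred_all:
  assumes "definable_pred M P"
  shows "definable_pred M (\<lambda>u. \<forall>a. P (u(n := a)))"
  using definable_pred_not[OF definable_pred_ex[OF definable_pred_not[OF assms]]] by simp

lemma definable_pred_mem:
  assumes "definable M S"
  shows "definable_pred M (\<lambda>u. u i \<in> S)"
proof -
  obtain \<phi> v where \<phi>: "wf_formula M \<phi>" "S = {x. sat M (v(0 := x)) \<phi>}"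
    using assms unfolding definable_def by blast
  \<comment> \<open>Variable 0 of the given formula becomes free variable \<open>i\<close>; its
    parameters, numbered from 1, go to the odd positions.\<close>
  define f where "f k = (case k of 0 \<Rightarrow> 2 * i | Suc j \<Rightarrow> 2 * j + 1)" for k
  have "inj f"
    by (rule injI) (auto simp: f_def split: nat.splits; presburger)
  moreover have "interleave u (\<lambda>k. v (Suc k)) \<circ> f = v(0 := u i)" for u
    by (auto simp: fun_eq_iff interleave_def f_def split: nat.splits)
  ultimately show ?thesis unfolding definable_pred_def using \<phi>
    by (intro exI[of _ "rename_formula f \<phi>"] exI[of _ "\<lambda>k. v (Suc k)"]) (simp add: sat_rename)
qed

text \<open>The way back to \<open>definable\<close>: free variable 0 sits at position 0, and all
  other values of \<open>u\<close> join \<open>w\<close> as parameters.\<close>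

lemma definable_Collect:
  assumes "definable_pred M P" "\<And>x. x \<in> S \<longleftrightarrow> P (u(0 := x))"
  shows "definable M S"
proof -
  obtain \<phi> w where "wf_formula M \<phi>" "\<And>u. P u \<longleftrightarrow> sat M (interleave u w) \<phi>"
    using assms unfolding definable_pred_def by blast
  then show ?thesis unfolding definable_def using assms(2)
    by (intro exI[of _ \<phi>] exI[of _ "interleave u w"]) (auto simp: interleave_upd)
qed

lemma definable_term_var: "definable_term M (\<lambda>u. u i)"
  unfolding definable_term_def
  by (intro exI[of _ "Var (2 * i)"] exI[of _ undefined]) (simp add: interleave_def)

lemma definable_term_const: "definable_term M (\<lambda>u. c)"
  unfolding definable_term_def
  \<comment> \<open>Position 1 holds the first parameter \<open>w 0\<close>.\<close>
  by (intro exI[of _ "Var 1"] exI[of _ "\<lambda>_. c"]) (simp add: interleave_def)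

lemma definable_terms_common:
  assumes "definable_term M F" "definable_term M G"
  obtains s t w where "wf_term M s" "wf_term M t" "\<And>u. F u = term_val M (interleave u w) s"
    "\<And>u. G u = term_val M (interleave u w) t"
proof -
  obtain s w t w' where "wf_term M s" "\<And>u. F u = term_val M (interleave u w) s"
    "wf_term M t" "\<And>u. G u = term_val M (interleave u w') t"
    using assms unfolding definable_term_def by blast
  then show ?thesis
    by (intro that[of "rename_term left_pos s" "rename_term right_pos t" "interleave w w'"])
      (simp_all add: interleave_left_pos interleave_right_pos)
qed

lemma definable_term_add:
  assumes "expands_real_field M" "definable_term M F" "definable_term M G"
  shows "definable_term M (\<lambda>u. F u + G u)"
proof -
  obtain p where p: "fun_arity M p = 2" "\<And>x y. fun_interp M p [x, y] = x + y"
    using assms(1) unfolding expands_real_field_def by blast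
  obtain s t w where "wf_term M s" "wf_term M t" "\<And>u. F u = term_val M (interleave u w) s"
    "\<And>u. G u = term_val M (interleave u w) t"
    using definable_terms_common[OF assms(2,3)] by blast
  with p show ?thesis unfolding definable_term_def
    by (intro exI[of _ "Fun p [s, t]"] exI[of _ w]) simp
qed

lemma definable_term_mult:
  assumes "expands_real_field M" "definable_term M F" "definable_term M G"
  shows "definable_term M (\<lambda>u. F u * G u)"
proof -
  obtain p where p: "fun_arity M p = 2" "\<And>x y. fun_interp M p [x, y] = x * y"
    using assms(1) unfolding expands_real_field_def by blast
  obtain s t w where "wf_term M s" "wf_term M t" "\<And>u. F u = term_val M (interleave u w) s"
    "\<And>u. G u = term_val M (interleave u w) t"
    using definable_terms_common[OF assms(2,3)] by blast
  with p show ?thesis unfolding definable_term_def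
    by (intro exI[of _ "Fun p [s, t]"] exI[of _ w]) simp
qed

lemma definable_pred_less:
  assumes "expands_real_field M" "definable_term M F" "definable_term M G"
  shows "definable_pred M (\<lambda>u. F u < G u)"
proof -
  obtain l where l: "rel_arity M l = 2" "\<And>x y. rel_interp M l [x, y] \<longleftrightarrow> x < y"
    using assms(1) unfolding expands_real_field_def by blast
  obtain s t w where "wf_term M s" "wf_term M t" "\<And>u. F u = term_val M (interleave u w) s"
    "\<And>u. G u = term_val M (interleave u w) t"
    using definable_terms_common[OF assms(2,3)] by blast
  with l show ?thesis unfolding definable_pred_def
    by (intro exI[of _ "Rel l [s, t]"] exI[of _ w]) simp
qed

lemma definable_pred_eq:
  assumes "definable_term M F" "definable_term M G"
  shows "definable_pred M (\<lambda>u. F u = G u)"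
proof -
  obtain s t w where "wf_term M s" "wf_term M t" "\<And>u. F u = term_val M (interleave u w) s"
    "\<And>u. G u = term_val M (interleave u w) t"
    using definable_terms_common[OF assms] by blast
  then show ?thesis unfolding definable_pred_def
    by (intro exI[of _ "Eq s t"] exI[of _ w]) simp
qed

lemmas definable_intros = definable_pred_not definable_pred_conj definable_pred_imp
  definable_pred_mem definable_pred_less definable_pred_eq
  definable_term_var definable_term_const definable_term_add definable_term_mult

section \<open>Definability of the sets used below\<close>

lemma definable_Int_Icc:
  assumes "expands_real_field M" "definable M S"
  shows "definable M (S \<inter> {a..b})"
proof (rule definable_Collect)
  show "definable_pred M (\<lambda>u. u 0 \<in> S \<and> \<not> u 0 < a \<and> \<not> b < u 0)"
    by (intro definable_intros assms)
qed (auto simp: not_less)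

lemma definable_Ioo_Diff:
  assumes "expands_real_field M" "definable M S"
  shows "definable M ({a<..<b} - S)"
proof (rule definable_Collect)
  show "definable_pred M (\<lambda>u. a < u 0 \<and> u 0 < b \<and> \<not> u 0 \<in> S)"
    by (intro definable_intros assms)
qed auto

text \<open>These are the values \<open>Inf (S \<inter> {y<..})\<close> that exceed
  \<open>y\<close>, for nonempty \<open>S \<inter> {y<..}\<close>, phrased without infima to be
  visibly first-order.\<close>

definition gap_ends :: "real set \<Rightarrow> real set" where
  "gap_ends S = {x. \<exists>y<x. (\<forall>z. y < z \<and> z < x \<longrightarrow> z \<notin> S) \<and> (\<forall>z>x. \<exists>s\<in>S. y < s \<and> s < z)}"

lemma definable_gap_ends:
  assumes "expands_real_field M" "definable M S"
  shows "definable M (gap_ends S)"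
proof (rule definable_Collect)
  \<comment> \<open>Variables 0, 1, 2, 3 stand for \<open>x\<close>, \<open>y\<close>,
    \<open>z\<close>, \<open>s\<close>; the quantifiers are added from the inside out.\<close>
  have A: "definable_pred M (\<lambda>u. \<forall>z. u 1 < z \<and> z < u 0 \<longrightarrow> z \<notin> S)"
  proof -
    have "definable_pred M (\<lambda>u. u 1 < u 2 \<and> u 2 < u 0 \<longrightarrow> \<not> u 2 \<in> S)"
      by (intro definable_intros assms)
    from definable_pred_all[OF this, of 2] show ?thesis by simp
  qed
  have B: "definable_pred M (\<lambda>u. \<exists>s. s \<in> S \<and> u 1 < s \<and> s < u 2)"
  proof -
    have "definable_pred M (\<lambda>u. u 3 \<in> S \<and> u 1 < u 3 \<and> u 3 < u 2)"
      by (intro definable_intros assms)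
    from definable_pred_ex[OF this, of 3] show ?thesis by simp
  qed
  have "definable_pred M (\<lambda>u. u 0 < u 2 \<longrightarrow> (\<exists>s. s \<in> S \<and> u 1 < s \<and> s < u 2))"
    by (intro definable_intros assms B)
  from definable_pred_all[OF this, of 2]
  have C: "definable_pred M (\<lambda>u. \<forall>z. u 0 < z \<longrightarrow> (\<exists>s. s \<in> S \<and> u 1 < s \<and> s < z))"
    by simp
  have "definable_pred M (\<lambda>u. u 1 < u 0 \<and> (\<forall>z. u 1 < z \<and> z < u 0 \<longrightarrow> z \<notin> S) \<and>
      (\<forall>z. u 0 < z \<longrightarrow> (\<exists>s. s \<in> S \<and> u 1 < s \<and> s < z)))"
    by (intro definable_intros assms A C)
  from definable_pred_ex[OF this, of 1]
  show "definable_pred M (\<lambda>u. \<exists>y. y < u 0 \<and> (\<forall>z. y < z \<and> z < u 0 \<longrightarrow> z \<notin> S) \<and>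
      (\<forall>z. u 0 < z \<longrightarrow> (\<exists>s. s \<in> S \<and> y < s \<and> s < z)))"
    by simp
qed (auto simp: gap_ends_def Bex_def)

text \<open>The exceptional slopes: \<open>t\<close> is one exactly when
  \<open>(a, b) \<mapsto> a - t * b\<close> fails to be injective on
  \<open>D \<times> D\<close>.\<close>

definition quotients :: "real set \<Rightarrow> real set" where
  "quotients D = {q. \<exists>a\<in>D. \<exists>b\<in>D. \<exists>c\<in>D. \<exists>d\<in>D. c \<noteq> d \<and> q = (a - b) / (c - d)}"

lemma definable_quotients:
  assumes "expands_real_field M" "definable M D"
  shows "definable M (quotients D)"
proof (rule definable_Collect[where u = "\<lambda>_. 0"])
  \<comment> \<open>Division and subtraction are cleared from the equation, leaving only sums and
    products.\<close>
  have "definable_pred M (\<lambda>u. u 1 \<in> D \<and> u 2 \<in> D \<and> u 3 \<in> D \<and> u 4 \<in> D \<and> \<not> u 3 = u 4 \<and>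
      u 0 * u 3 + u 2 = u 0 * u 4 + u 1)"
    by (intro definable_intros assms)
  from definable_pred_ex[OF definable_pred_ex[OF definable_pred_ex[OF definable_pred_ex[OF this,
          of 4], of 3], of 2], of 1]
  show "definable_pred M (\<lambda>u. \<exists>a b c d. a \<in> D \<and> b \<in> D \<and> c \<in> D \<and> d \<in> D \<and> \<not> c = d \<and>
      u 0 * c + b = u 0 * d + a)"
    by simp
next
  fix q :: real
  have "q = (a - b) / (c - d) \<longleftrightarrow> q * c + b = q * d + a" if "c \<noteq> d" for a b c d
    using that by (auto simp: field_simps)
  then show "q \<in> quotients D \<longleftrightarrow> (\<exists>a b c d. a \<in> D \<and> b \<in> D \<and> c \<in> D \<and> d \<in> D \<and> \<not> c = d \<and>
      ((\<lambda>_. 0)(0 := q)) 0 * c + b = ((\<lambda>_. 0)(0 := q)) 0 * d + a)"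
    unfolding quotients_def mem_Collect_eq Bex_def fun_upd_same by metis
qed

definition scaled_sum :: "real \<Rightarrow> real set \<Rightarrow> real set" where
  "scaled_sum t D = (\<lambda>(a, b). a + t * b) ` (D \<times> D)"

lemma definable_scaled_sum:
  assumes "expands_real_field M" "definable M D"
  shows "definable M (scaled_sum t D)"
proof (rule definable_Collect)
  have "definable_pred M (\<lambda>u. u 1 \<in> D \<and> u 2 \<in> D \<and> u 0 = u 1 + t * u 2)"
    by (intro definable_intros assms)
  from definable_pred_ex[OF definable_pred_ex[OF this, of 2], of 1]
  show "definable_pred M (\<lambda>u. \<exists>a b. a \<in> D \<and> b \<in> D \<and> u 0 = a + t * b)"
    by simp
qed (auto simp: scaled_sum_def)

section \<open>Gap endpoints\<close>

text \<open>Each gap contains a rational \<open>q\<close>, and \<open>q\<close> determines the right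
  endpoint of its gap as \<open>Inf (S \<inter> {q<..})\<close>.\<close>

lemma countable_gap_ends: "countable (gap_ends S)"
proof (rule countable_subset)
  show "gap_ends S \<subseteq> (\<lambda>q. Inf (S \<inter> {q<..})) ` \<rat>"
  proof
    fix x assume "x \<in> gap_ends S"
    then obtain y where y: "y < x" "\<And>z. y < z \<Longrightarrow> z < x \<Longrightarrow> z \<notin> S"
      "\<And>z. x < z \<Longrightarrow> \<exists>s\<in>S. y < s \<and> s < z"
      unfolding gap_ends_def by blast
    obtain q where q: "q \<in> \<rat>" "y < q" "q < x"
      using Rats_dense_in_real[OF y(1)] by blast
    have "Inf (S \<inter> {q<..}) = x"
    proof (rule cInf_eq_non_empty)
      show "S \<inter> {q<..} \<noteq> {}"
        using y q by (metis IntI empty_iff greaterThan_iff less_add_one less_le_trans not_less)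
      show "x \<le> s" if "s \<in> S \<inter> {q<..}" for s
        using that y(2)[of s] q by force
      show "c \<le> x" if "\<And>s. s \<in> S \<inter> {q<..} \<Longrightarrow> c \<le> s" for c
      proof (rule ccontr)
        assume "\<not> c \<le> x"
        then obtain s where "s \<in> S" "y < s" "s < c" using y(3)[of c] by auto
        with that[of s] y(2)[of s] q show False by fastforce
      qed
    qed
    with q show "x \<in> (\<lambda>q. Inf (S \<inter> {q<..})) ` \<rat>" by force
  qed
qed (simp add: countable_rat)

text \<open>Makes \<open>gap_ends S\<close> inherit boundedness from \<open>S\<close>. A point of
  \<open>S\<close> between \<open>y\<close> and \<open>x + e\<close> cannot lie in the gap, so it is
  within \<open>e\<close> of \<open>x\<close>.\<close>

lemma gap_ends_subset_closure: "gap_ends S \<subseteq> closure S"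
proof
  fix x assume "x \<in> gap_ends S"
  then obtain y where y: "y < x" "\<And>z. y < z \<Longrightarrow> z < x \<Longrightarrow> z \<notin> S"
    "\<And>z. x < z \<Longrightarrow> \<exists>s\<in>S. y < s \<and> s < z"
    unfolding gap_ends_def by blast
  have "\<exists>s\<in>S. dist s x < e" if "e > 0" for e
  proof -
    obtain s where "s \<in> S" "y < s" "s < x + e" using y(3)[of "x + e"] \<open>e > 0\<close> by auto
    with y(2)[of s] that show ?thesis
      by (intro bexI[of _ s]) (force simp: dist_real_def)+
  qed
  then show "x \<in> closure S" by (simp add: closure_approachable)
qed

text \<open>Arbitrarily close to the left of a point \<open>x\<close> of \<open>S\<close> there is
  some \<open>p\<close> outside \<open>closure S\<close>. The infimum of \<open>S\<close> to the
  right of \<open>p\<close> ends the gap around \<open>p\<close> and lies between \<open>p\<close>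
  and \<open>x\<close>.\<close>

lemma subset_closure_gap_ends:
  assumes "nowhere_dense S"
  shows "S \<subseteq> closure (gap_ends S)"
proof
  fix x assume x: "x \<in> S"
  have "\<exists>w\<in>gap_ends S. dist w x < e" if "e > 0" for e
  proof -
    have "\<not> {x - e<..<x} \<subseteq> closure S"
    proof
      assume "{x - e<..<x} \<subseteq> closure S"
      then have "{x - e<..<x} \<subseteq> interior (closure S)" by (simp add: interior_maximal)
      with assms \<open>e > 0\<close> show False by (auto simp: nowhere_dense_def)
    qed
    then obtain p where p: "x - e < p" "p < x" "p \<notin> closure S"
      unfolding subset_iff greaterThanLessThan_iff by blast
    then obtain d where d: "d > 0" "\<And>s. s \<in> S \<Longrightarrow> d \<le> dist s p"
      by (auto simp: closure_approachable not_less)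
    define w where "w = Inf (S \<inter> {p..})"
    have bdd: "bdd_below (S \<inter> {p..})" by (rule bdd_belowI[of _ p]) auto
    have wx: "w \<le> x" unfolding w_def using bdd x p by (intro cInf_lower) auto
    \<comment> \<open>The positive distance from \<open>p\<close> to \<open>S\<close> makes the gap
      \<open>(p, w)\<close> nonempty.\<close>
    have pw: "p + d \<le> w" unfolding w_def
    proof (rule cInf_greatest)
      show "S \<inter> {p..} \<noteq> {}" using x p by force
      show "p + d \<le> s" if "s \<in> S \<inter> {p..}" for s
        using d(2)[of s] that by (auto simp: dist_real_def)
    qed
    have "w \<in> gap_ends S" unfolding gap_ends_def
    proof (intro CollectI exI[of _ p] conjI allI impI)
      show "p < w" using pw d by simp
      show "z \<notin> S" if "p < z \<and> z < w" for z
        using that cInf_lower[OF _ bdd, of z] unfolding w_def by force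
      show "\<exists>s\<in>S. p < s \<and> s < z" if "w < z" for z
      proof -
        obtain s where s: "s \<in> S \<inter> {p..}" "s < z"
          using cInf_lessD[of "S \<inter> {p..}" z] \<open>w < z\<close> x p unfolding w_def by force
        have "s \<noteq> p" using s d(2)[of s] d(1) by auto
        with s show ?thesis by force
      qed
    qed
    moreover have "dist w x < e" using wx pw d p by (auto simp: dist_real_def)
    ultimately show ?thesis by blast
  qed
  then show "x \<in> closure (gap_ends S)" by (simp add: closure_approachable)
qed

section \<open>Separated sets\<close>

definition separated :: "real \<Rightarrow> real set \<Rightarrow> bool" where
  "separated r F \<longleftrightarrow> (\<forall>x\<in>F. \<forall>y\<in>F. x \<noteq> y \<longrightarrow> r \<le> \<bar>x - y\<bar>)"

text \<open>Two points in one cell of length \<open>r\<close> would be closer than \<open>r\<close>,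
  so the points have distinct values \<open>\<lfloor>x / r\<rfloor>\<close>, and these are counted.
  The bound \<open>r \<le> 1\<close> makes the result independent of \<open>r\<close>.\<close>

lemma card_separated_bounded:
  assumes "F \<subseteq> {-B..B}" "finite F" "separated r F" "0 < r" "r \<le> 1" "0 \<le> B"
  shows "real (card F) * r \<le> 2 * B + 2"
proof -
  have "inj_on (\<lambda>x. \<lfloor>x / r\<rfloor>) F"
  proof (rule inj_onI, rule ccontr)
    fix x y assume xy: "x \<in> F" "y \<in> F" "\<lfloor>x / r\<rfloor> = \<lfloor>y / r\<rfloor>" "x \<noteq> y"
    then have "\<bar>x / r - y / r\<bar> < 1" by linarith
    then have "\<bar>x - y\<bar> < r" using assms(4) by (simp add: diff_divide_distrib[symmetric])
    with xy assms(3) show False by (force simp: separated_def)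
  qed
  moreover have "(\<lambda>x. \<lfloor>x / r\<rfloor>) ` F \<subseteq> {\<lfloor>-B / r\<rfloor>..\<lfloor>B / r\<rfloor>}"
  proof
    fix i assume "i \<in> (\<lambda>x. \<lfloor>x / r\<rfloor>) ` F"
    then obtain x where x: "x \<in> F" "i = \<lfloor>x / r\<rfloor>" by blast
    then have "- B \<le> x" "x \<le> B" using assms(1) by auto
    then show "i \<in> {\<lfloor>-B / r\<rfloor>..\<lfloor>B / r\<rfloor>}"
      using assms(4) unfolding x(2) atLeastAtMost_iff by (intro conjI floor_mono divide_right_mono) auto
  qed
  ultimately have "card F \<le> card {\<lfloor>-B / r\<rfloor>..\<lfloor>B / r\<rfloor>}"
    by (intro card_inj_on_le) auto
  then have "real (card F) \<le> real (nat (\<lfloor>B / r\<rfloor> + 1 - \<lfloor>-B / r\<rfloor>))" by simp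
  also have "\<dots> = real_of_int (\<lfloor>B / r\<rfloor> + 1 - \<lfloor>-B / r\<rfloor>)"
  proof -
    have "\<lfloor>-B / r\<rfloor> \<le> \<lfloor>B / r\<rfloor>" using assms by (intro floor_mono divide_right_mono) auto
    then show ?thesis by simp
  qed
  also have "\<dots> \<le> B / r + 2 - (- B / r)" by linarith
  finally have "real (card F) * r \<le> (B / r + 2 - (- B / r)) * r"
    using assms(4) by (intro mult_right_mono) auto
  also have "\<dots> = 2 * B + 2 * r" using assms(4) by (simp add: field_simps)
  finally show ?thesis using assms(5) by simp
qed

section \<open>Countable definable sets in an i-minimal structure\<close>

lemma interior_countable_real:
  assumes "countable (D :: real set)"
  shows "interior D = {}"
proof (rule ccontr)
  assume "interior D \<noteq> {}"
  then obtain x e where "e > 0" "ball x e \<subseteq> D"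
    by (metis ex_in_conv mem_interior)
  then show False using assms countable_subset uncountable_ball by blast
qed

text \<open>Countability excludes interior, so i-minimality makes \<open>D\<close> nowhere dense;
  any point outside its closure serves as \<open>t\<close>. Countability alone would give no
  positive distance \<open>e\<close>.\<close>

lemma i_minimal_countable_avoids:
  assumes "i_minimal M" "definable M D" "countable D"
  obtains t e where "0 < e" "\<And>q. q \<in> D \<Longrightarrow> e \<le> \<bar>q - t\<bar>"
proof -
  have "interior (closure D) = {}"
    using assms interior_countable_real unfolding i_minimal_def nowhere_dense_def by blast
  then have "closure D \<noteq> UNIV" by (metis UNIV_not_empty interior_UNIV)
  then obtain t where "t \<notin> closure D" by blast
  then obtain e where "e > 0" "\<forall>q\<in>D. e \<le> dist q t"
    by (auto simp: closure_approachable not_less)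
  then show ?thesis using that by (auto simp: dist_real_def)
qed

lemma countable_quotients:
  assumes "countable D"
  shows "countable (quotients D)"
proof (rule countable_subset)
  show "quotients D \<subseteq> (\<lambda>(a, b, c, d). (a - b) / (c - d)) ` (D \<times> D \<times> D \<times> D)"
    by (force simp: quotients_def)
qed (use assms in auto)

text \<open>Induction on \<open>k\<close> for all \<open>D\<close> at once: the step applies the
  hypothesis to \<open>scaled_sum (- t) D\<close>. Passing from \<open>F\<close> to the image of
  \<open>F \<times> F\<close> squares the cardinality, which doubles the exponent, and shrinks the
  separation only by the factor \<open>e\<close>.\<close>

lemma card_power_separated:
  assumes "expands_real_field M" "i_minimal M"
  assumes "definable M D" "countable D" "bounded D"
  shows "\<exists>C. \<forall>r F. 0 < r \<longrightarrow> r \<le> 1 \<longrightarrow> F \<subseteq> D \<longrightarrow> finite F \<longrightarrow> separated r F \<longrightarrow>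
    real (card F) ^ (2 ^ k) * r \<le> C"
  using assms(3-5)
proof (induction k arbitrary: D)
  case 0
  then obtain B where B: "B > 0" "\<And>x. x \<in> D \<Longrightarrow> \<bar>x\<bar> \<le> B"
    unfolding bounded_pos by auto
  then have "F \<subseteq> {-B..B}" if "F \<subseteq> D" for F using that by (force simp: abs_le_iff)
  with B show ?case
    by (intro exI[of _ "2 * B + 2"] allI impI) (simp add: card_separated_bounded)
next
  case (Suc k)
  obtain t e0 where e0: "0 < e0" "\<And>q. q \<in> quotients D \<Longrightarrow> e0 \<le> \<bar>q - t\<bar>"
    using i_minimal_countable_avoids[OF assms(2) definable_quotients[OF assms(1) Suc.prems(1)]
        countable_quotients[OF Suc.prems(2)]] by blast
  \<comment> \<open>With \<open>e \<le> 1\<close>, the scale \<open>e * r\<close> stays at most 1,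
    as the induction hypothesis requires, and at most \<open>r\<close>, as the case
    \<open>b = b'\<close> requires.\<close>
  define e where "e = min e0 1"
  have e: "0 < e" "e \<le> 1" "\<And>q. q \<in> quotients D \<Longrightarrow> e \<le> \<bar>q - t\<bar>"
    using e0 by (force simp: e_def)+
  let ?g = "\<lambda>(a, b). a + (- t) * b"
  have "bounded (scaled_sum (- t) D)"
  proof -
    obtain B where "\<And>x. x \<in> D \<Longrightarrow> \<bar>x\<bar> \<le> B"
      using Suc.prems(3) unfolding bounded_iff by auto
    then have "\<bar>a + (- t) * b\<bar> \<le> B + \<bar>t\<bar> * B" if "a \<in> D" "b \<in> D" for a b
      using that mult_left_mono[of "\<bar>b\<bar>" B "\<bar>t\<bar>"] abs_triangle_ineq[of a "(- t) * b"]
      by (fastforce simp: abs_mult)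
    then show ?thesis unfolding bounded_iff scaled_sum_def
      by (intro exI[of _ "B + \<bar>t\<bar> * B"]) auto
  qed
  moreover have "countable (scaled_sum (- t) D)"
    unfolding scaled_sum_def using Suc.prems(2) by auto
  ultimately obtain C where C: "\<And>r F. 0 < r \<Longrightarrow> r \<le> 1 \<Longrightarrow> F \<subseteq> scaled_sum (- t) D \<Longrightarrow>
      finite F \<Longrightarrow> separated r F \<Longrightarrow> real (card F) ^ (2 ^ k) * r \<le> C"
    using Suc.IH[OF definable_scaled_sum[OF assms(1) Suc.prems(1)]] by meson
  show ?case
  proof (intro exI[of _ "C / e"] allI impI)
    fix r F assume r: "0 < r" "r \<le> 1" and F: "F \<subseteq> D" "finite F" "separated r F"
    \<comment> \<open>As \<open>t\<close> stays away from the quotients, \<open>(a, b) \<mapsto> a - t b\<close> keeps points of \<open>F \<times> F\<close> apart.\<close>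
    have sep: "e * r \<le> \<bar>?g (a, b) - ?g (a', b')\<bar>"
      if m: "a \<in> F" "b \<in> F" "a' \<in> F" "b' \<in> F" and ne: "(a, b) \<noteq> (a', b')" for a b a' b'
    proof (cases "b = b'")
      case True
      then have "r \<le> \<bar>a - a'\<bar>" using F(3) m ne by (auto simp: separated_def)
      moreover have "e * r \<le> r" using r e by simp
      ultimately show ?thesis using True by simp
    next
      case False
      \<comment> \<open>The images differ by \<open>b - b'\<close> times the difference between this
        quotient and \<open>t\<close>; the factors are at least \<open>r\<close> and
        \<open>e\<close> in absolute value.\<close>
      have "(a - a') / (b - b') \<in> quotients D"
        using False m F(1) by (force simp: quotients_def)
      then have "e \<le> \<bar>(a - a') / (b - b') - t\<bar>" by (rule e)
      moreover have "r \<le> \<bar>b - b'\<bar>" using F(3) m False by (auto simp: separated_def)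
      ultimately have "e * r \<le> \<bar>(a - a') / (b - b') - t\<bar> * \<bar>b - b'\<bar>"
        using e r by (intro mult_mono) auto
      also have "\<dots> = \<bar>?g (a, b) - ?g (a', b')\<bar>"
        using False by (simp add: abs_mult[symmetric] field_simps)
      finally show ?thesis .
    qed
    have inj: "inj_on ?g (F \<times> F)"
    proof (rule inj_onI, rule ccontr)
      fix p p' assume p: "p \<in> F \<times> F" "p' \<in> F \<times> F" "?g p = ?g p'" "p \<noteq> p'"
      obtain a b a' b' where [simp]: "p = (a, b)" "p' = (a', b')" by (cases p; cases p')
      have "e * r \<le> \<bar>?g p - ?g p'\<bar>" using sep[of a b a' b'] p by simp
      moreover have "0 < e * r" using e r by simp
      ultimately show False using p(3) by linarith
    qed
    have "separated (e * r) (?g ` (F \<times> F))"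
      unfolding separated_def
    proof (intro ballI impI)
      fix x y assume "x \<in> ?g ` (F \<times> F)" "y \<in> ?g ` (F \<times> F)" and ne: "x \<noteq> y"
      then obtain a b a' b' where "a \<in> F" "b \<in> F" "a' \<in> F" "b' \<in> F"
        "x = ?g (a, b)" "y = ?g (a', b')" by blast
      with ne sep[of a b a' b'] show "e * r \<le> \<bar>x - y\<bar>" by blast
    qed
    then have "real (card (?g ` (F \<times> F))) ^ (2 ^ k) * (e * r) \<le> C"
      using e r F by (intro C) (auto simp: scaled_sum_def mult_le_one)
    moreover have "real (card (?g ` (F \<times> F))) = real (card F) ^ 2"
      using inj by (simp add: card_image card_cartesian_product power2_eq_square)
    ultimately have "(real (card F) ^ 2) ^ (2 ^ k) * (e * r) \<le> C" by simp
    then have "real (card F) ^ (2 ^ Suc k) * (e * r) \<le> C"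
      by (simp only: power_mult[symmetric] power_Suc)
    then show "real (card F) ^ (2 ^ Suc k) * r \<le> C / e"
      using e by (simp add: field_simps)
  qed
qed

section \<open>Hausdorff null sets\<close>

lemma hausdorff_measure_zeroI:
  assumes "\<And>\<delta> e. 0 < \<delta> \<Longrightarrow> 0 < e \<Longrightarrow> \<exists>U. A \<subseteq> (\<Union>i::nat. U i) \<and>
    (\<forall>i. bounded (U i) \<and> diameter (U i) \<le> \<delta>) \<and> (\<Sum>i. diam_power s (U i)) \<le> ennreal e"
  shows "hausdorff_measure s A = 0"
proof -
  have "hausdorff_premeasure s \<delta> A \<le> 0" if "0 < \<delta>" for \<delta>
  proof (rule ennreal_le_epsilon)
    fix e :: real assume "0 < e"
    then obtain U where "A \<subseteq> (\<Union>i::nat. U i)" "\<forall>i. bounded (U i) \<and> diameter (U i) \<le> \<delta>"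
      "(\<Sum>i. diam_power s (U i)) \<le> ennreal e"
      using assms \<open>0 < \<delta>\<close> by blast
    then show "hausdorff_premeasure s \<delta> A \<le> 0 + ennreal e"
      unfolding hausdorff_premeasure_def by (intro INF_lower2[of U]) auto
  qed
  then show ?thesis unfolding hausdorff_measure_def
    by (metis SUP_least greaterThan_iff le_zero_eq)
qed

lemma hausdorff_measure_zeroD:
  assumes "hausdorff_measure s A = 0" "0 < \<delta>" "0 < e"
  obtains U :: "nat \<Rightarrow> 'a::metric_space set" where "A \<subseteq> (\<Union>i. U i)"
    "\<And>i. bounded (U i)" "\<And>i. diameter (U i) \<le> \<delta>" "(\<Sum>i. diam_power s (U i)) \<le> ennreal e"
proof -
  have "hausdorff_premeasure s \<delta> A \<le> hausdorff_measure s A"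
    unfolding hausdorff_measure_def using assms(2) by (intro SUP_upper) auto
  with assms have "hausdorff_premeasure s \<delta> A < ennreal e" by simp
  then obtain U where "A \<subseteq> (\<Union>i::nat. U i)" "\<forall>i. bounded (U i) \<and> diameter (U i) \<le> \<delta>"
    "(\<Sum>i. diam_power s (U i)) < ennreal e"
    unfolding hausdorff_premeasure_def INF_less_iff by blast
  then show ?thesis using that[of U] by auto
qed

text \<open>The \<open>n\<close>-th set gets a cover of cost at most \<open>e / 2 ^ (n + 1)\<close>;
  a pairing function merges these covers into one sequence.\<close>

lemma hausdorff_measure_UN_zero:
  fixes A :: "nat \<Rightarrow> 'a::metric_space set"
  assumes "\<And>n. hausdorff_measure s (A n) = 0"
  shows "hausdorff_measure s (\<Union>n. A n) = 0"
proof (rule hausdorff_measure_zeroI)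
  fix \<delta> e :: real assume "0 < \<delta>" "0 < e"
  then have "\<exists>U. A n \<subseteq> (\<Union>i::nat. U i) \<and> (\<forall>i. bounded (U i) \<and> diameter (U i) \<le> \<delta>) \<and>
      (\<Sum>i. diam_power s (U i)) \<le> ennreal (e * (1 / 2) ^ Suc n)" for n
    using hausdorff_measure_zeroD[OF assms[of n] \<open>0 < \<delta>\<close>, of "e * (1 / 2) ^ Suc n"]
    by (metis mult_pos_pos zero_less_power half_gt_zero zero_less_one)
  then obtain U where U: "\<And>n. A n \<subseteq> (\<Union>i::nat. U n i)"
      "\<And>n i. bounded (U n i) \<and> diameter (U n i) \<le> \<delta>"
      "\<And>n. (\<Sum>i. diam_power s (U n i)) \<le> ennreal (e * (1 / 2) ^ Suc n)"
    by metis
  define V where "V i = (case prod_decode i of (n, m) \<Rightarrow> U n m)" for i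
  have "(\<Union>n. A n) \<subseteq> (\<Union>i. V i)"
  proof
    fix x assume "x \<in> (\<Union>n. A n)"
    then obtain n m where "x \<in> U n m" using U(1) by blast
    then have "x \<in> V (prod_encode (n, m))" by (simp add: V_def)
    then show "x \<in> (\<Union>i. V i)" by blast
  qed
  moreover have "\<forall>i. bounded (V i) \<and> diameter (V i) \<le> \<delta>"
    using U(2) by (simp add: V_def split: prod.split)
  moreover have "(\<Sum>i. diam_power s (V i)) \<le> ennreal e"
  proof -
    have "(\<Sum>i. diam_power s (V i)) =
        (\<Sum>i. (\<lambda>(n, m). diam_power s (U n m)) (prod_decode i))"
      by (simp add: V_def case_prod_unfold)
    also have "\<dots> = (\<Sum>n. \<Sum>m. diam_power s (U n m))"
      by (rule suminf_ennreal_2dimen) simp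
    also have "\<dots> \<le> (\<Sum>n. ennreal (e * (1 / 2) ^ Suc n))"
      using U(3) by (intro suminf_le) auto
    also have "\<dots> = ennreal (e * 1)"
      using \<open>0 < e\<close> by (intro suminf_ennreal_eq sums_mult power_half_series) auto
    finally show ?thesis by simp
  qed
  ultimately show "\<exists>V. (\<Union>n. A n) \<subseteq> (\<Union>i::nat. V i) \<and>
      (\<forall>i. bounded (V i) \<and> diameter (V i) \<le> \<delta>) \<and> (\<Sum>i. diam_power s (V i)) \<le> ennreal e"
    by blast
qed

section \<open>Coverings by balls around separated points\<close>

lemma finite_cball_cover:
  fixes F :: "real set"
  assumes "finite F" "A \<subseteq> (\<Union>x\<in>F. cball x r)" "0 < r" "0 < s"
  obtains U where "A \<subseteq> (\<Union>i::nat. U i)" "\<And>i. bounded (U i)" "\<And>i. diameter (U i) \<le> 2 * r"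
    "(\<Sum>i. diam_power s (U i)) \<le> ennreal (real (card F) * (2 * r) powr s)"
proof -
  obtain h where h: "bij_betw h {0..<card F} F"
    using ex_bij_betw_nat_finite[OF assms(1)] by blast
  \<comment> \<open>The finite cover is padded with empty sets, to which \<open>diam_power\<close>
    assigns 0.\<close>
  define U where "U i = (if i < card F then cball (h i) r else {})" for i
  have "(\<Sum>i. diam_power s (U i)) = (\<Sum>i<card F. diam_power s (U i))"
    by (rule suminf_finite) (auto simp: U_def diam_power_def)
  also have "\<dots> \<le> (\<Sum>i<card F. ennreal ((2 * r) powr s))"
    using assms by (intro sum_mono) (auto simp: U_def diam_power_def)
  also have "\<dots> = ennreal (real (card F) * (2 * r) powr s)"
    by (simp add: ennreal_mult ennreal_of_nat_eq_real_of_nat)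
  finally have *: "(\<Sum>i. diam_power s (U i)) \<le> ennreal (real (card F) * (2 * r) powr s)" .
  have "A \<subseteq> (\<Union>i. U i)"
  proof
    fix x assume "x \<in> A"
    then obtain y where "y \<in> F" "x \<in> cball y r" using assms(2) by blast
    moreover obtain i where "i < card F" "y = h i"
      using h \<open>y \<in> F\<close> by (metis atLeastLessThan_iff bij_betw_def imageE)
    ultimately have "x \<in> U i" by (simp add: U_def)
    then show "x \<in> (\<Union>i. U i)" by blast
  qed
  moreover have "bounded (U i)" "diameter (U i) \<le> 2 * r" for i
    using assms by (auto simp: U_def)
  ultimately show ?thesis using that * by blast
qed

text \<open>A separated set of largest cardinality works: a point farther than \<open>r\<close> from
  all its members could be added to it.\<close>

lemma maximal_separated_cover:
  assumes "\<And>F. F \<subseteq> D \<Longrightarrow> finite F \<Longrightarrow> separated r F \<Longrightarrow> card F \<le> b" "0 < r"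
  obtains F where "F \<subseteq> D" "finite F" "separated r F" "D \<subseteq> (\<Union>x\<in>F. cball x r)"
proof -
  obtain F where F: "F \<subseteq> D" "finite F" "separated r F"
    and max: "\<And>G. G \<subseteq> D \<Longrightarrow> finite G \<Longrightarrow> separated r G \<Longrightarrow> card G \<le> card F"
    using ex_has_greatest_nat[of "\<lambda>F. F \<subseteq> D \<and> finite F \<and> separated r F" "{}" card "Suc b"] assms(1)
    by (fastforce simp: separated_def less_Suc_eq_le)
  have "x \<in> (\<Union>y\<in>F. cball y r)" if "x \<in> D" for x
  proof (rule ccontr)
    assume x: "x \<notin> (\<Union>y\<in>F. cball y r)"
    then have far: "r < \<bar>y - x\<bar>" if "y \<in> F" for y using that by (auto simp: dist_real_def)
    then have "separated r (insert x F)"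
      using F(3) by (force simp: separated_def abs_minus_commute)
    moreover have "x \<notin> F" using far[of x] assms(2) by auto
    ultimately show False using max[of "insert x F"] F \<open>x \<in> D\<close> by simp
  qed
  with F show ?thesis using that by blast
qed

section \<open>From i-minimality to Hausdorff dimension 0\<close>

lemma hausdorff_measure_bounded_zero:
  assumes M: "expands_real_field M" "i_minimal M"
    and S: "definable M S" "bounded S" "nowhere_dense S" and s: "0 < s"
  shows "hausdorff_measure s S = 0"
proof (rule hausdorff_measure_zeroI)
  fix \<delta> e :: real assume pos: "0 < \<delta>" "0 < e"
  let ?D = "gap_ends S"
  \<comment> \<open>With \<open>s * 2 ^ k \<ge> 2\<close>, the power
    \<open>(2 * r) powr (s * 2 ^ k)\<close> outweighs the factor \<open>1 / r\<close> in the bound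
    on separated sets.\<close>
  obtain k where "2 / s < 2 ^ k" using real_arch_pow[of 2 "2 / s"] by auto
  then have k: "2 \<le> s * 2 ^ k" using s by (simp add: field_simps)
  have "bounded ?D"
    using gap_ends_subset_closure S(2) by (metis bounded_closure bounded_subset)
  from card_power_separated[OF M definable_gap_ends[OF M(1) S(1)] countable_gap_ends this, of k]
  obtain C0 where C0: "\<And>r F. 0 < r \<Longrightarrow> r \<le> 1 \<Longrightarrow> F \<subseteq> ?D \<Longrightarrow> finite F \<Longrightarrow> separated r F \<Longrightarrow>
    real (card F) ^ (2 ^ k) * r \<le> C0" by meson
  define C where "C = max C0 1"
  have C: "C > 0" "\<And>r F. 0 < r \<Longrightarrow> r \<le> 1 \<Longrightarrow> F \<subseteq> ?D \<Longrightarrow> finite F \<Longrightarrow> separated r F \<Longrightarrow>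
    real (card F) ^ (2 ^ k) \<le> C / r"
  proof -
    show "C > 0" by (simp add: C_def)
    show "real (card F) ^ (2 ^ k) \<le> C / r"
      if "0 < r" "r \<le> 1" "F \<subseteq> ?D" "finite F" "separated r F" for r F
      using C0[OF that] that(1) by (simp add: C_def pos_le_divide_eq)
  qed
  \<comment> \<open>The three bounds keep ball diameters below \<open>\<delta>\<close>, make powers
    of \<open>2 * r\<close> decrease in the exponent, and force
    \<open>4 * C * r \<le> e ^ (2 ^ k)\<close>.\<close>
  define r where "r = Min {\<delta> / 2, 1 / 2, e ^ (2 ^ k) / (4 * C)}"
  have r: "0 < r" "2 * r \<le> \<delta>" "2 * r \<le> 1" "r \<le> e ^ (2 ^ k) / (4 * C)"
    using pos C(1) by (auto simp: r_def)
  \<comment> \<open>A crude bound, enough for a separated set of largest size to exist.\<close>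
  have "card F \<le> nat \<lceil>C / r\<rceil>" if F: "F \<subseteq> ?D" "finite F" "separated r F" for F
  proof -
    have "real (card F) \<le> real (card F) ^ (2 ^ k)"
      by (cases "card F = 0") (auto intro!: self_le_power)
    also have "\<dots> \<le> C / r" using C(2)[of r F] r F by simp
    finally show ?thesis by linarith
  qed
  then obtain F where F: "F \<subseteq> ?D" "finite F" "separated r F" "?D \<subseteq> (\<Union>x\<in>F. cball x r)"
    using maximal_separated_cover r(1) by metis
  \<comment> \<open>A finite union of closed balls is closed, so a cover of the countable set
    \<open>?D\<close> already covers \<open>S\<close>.\<close>
  have "closure ?D \<subseteq> (\<Union>x\<in>F. cball x r)"
    using F by (intro closure_minimal) auto
  then have cov: "S \<subseteq> (\<Union>x\<in>F. cball x r)"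
    using subset_closure_gap_ends[OF S(3)] by blast
  \<comment> \<open>The total cost of the cover is compared with \<open>e\<close> after raising both
    to the power \<open>2 ^ k\<close>.\<close>
  have "(real (card F) * (2 * r) powr s) ^ (2 ^ k) = real (card F) ^ (2 ^ k) * (2 * r) powr (s * 2 ^ k)"
    using r(1) by (simp add: power_mult_distrib powr_power mult.commute)
  also have "\<dots> \<le> (C / r) * (2 * r) powr 2"
    using C r F k by (intro mult_mono powr_mono') auto
  also have "\<dots> = 4 * C * r"
    using r(1) by (simp add: powr_numeral power2_eq_square)
  also have "\<dots> \<le> e ^ (2 ^ k)"
    using r(4) C(1) by (simp add: field_simps)
  finally have "real (card F) * (2 * r) powr s \<le> e"
    using pos by (simp add: power_mono_iff)
  moreover obtain U where U: "S \<subseteq> (\<Union>i::nat. U i)" "\<And>i. bounded (U i)"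
    "\<And>i. diameter (U i) \<le> 2 * r"
    "(\<Sum>i. diam_power s (U i)) \<le> ennreal (real (card F) * (2 * r) powr s)"
    using finite_cball_cover[OF F(2) cov r(1) s] by blast
  ultimately show "\<exists>U. S \<subseteq> (\<Union>i::nat. U i) \<and> (\<forall>i. bounded (U i) \<and> diameter (U i) \<le> \<delta>) \<and>
      (\<Sum>i. diam_power s (U i)) \<le> ennreal e"
    using r(2) by (intro exI[of _ U]) (auto intro: order_trans ennreal_leI)
qed

text \<open>\<open>S\<close> is exhausted by its bounded pieces in \<open>[-n, n]\<close>, so its
  measure vanishes for every exponent \<open>s > 0\<close>.\<close>

lemma i_minimal_imp_hausdorff_dim_zero:
  assumes M: "expands_real_field M" "i_minimal M" and S: "definable M S" "interior S = {}"
  shows "hausdorff_dim S = 0"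
proof -
  have nd: "nowhere_dense S" using M(2) S unfolding i_minimal_def by blast
  have "hausdorff_measure s S = 0" if "0 < s" for s
  proof -
    have "hausdorff_measure s (S \<inter> {- real n..real n}) = 0" for n
    proof (rule hausdorff_measure_bounded_zero[OF M _ _ _ that])
      show "nowhere_dense (S \<inter> {- real n..real n})"
        using nd unfolding nowhere_dense_def
        by (metis Int_lower1 closure_mono interior_mono subset_empty)
    qed (auto intro: definable_Int_Icc M S bounded_Int)
    then have "hausdorff_measure s (\<Union>n. S \<inter> {- real n..real n}) = 0"
      by (rule hausdorff_measure_UN_zero)
    moreover have "(\<Union>n. S \<inter> {- real n..real n}) = S"
    proof -
      have "\<exists>n. - real n \<le> x \<and> x \<le> real n" for x
        using real_arch_simple[of "\<bar>x\<bar>"] by (auto simp: abs_le_iff minus_le_iff)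
      then show ?thesis by auto
    qed
    ultimately show ?thesis by simp
  qed
  then have le: "hausdorff_dim S \<le> ennreal s" if "0 < s" for s
    unfolding hausdorff_dim_def using that by (intro Inf_lower CollectI exI[of _ s]) simp
  have "hausdorff_dim S \<le> 0"
    by (rule ennreal_le_epsilon) (simp only: add_0 le)
  then show ?thesis by simp
qed

section \<open>From Hausdorff dimension 0 to null sets, and back to i-minimality\<close>

lemma hausdorff_measure_zero_imp_null:
  fixes S :: "real set"
  assumes "hausdorff_measure s S = 0" "0 \<le> s" "s \<le> 1"
  shows "S \<in> null_sets lebesgue"
proof -
  have "\<exists>T. S \<subseteq> T \<and> T \<in> lmeasurable \<and> measure lebesgue T \<le> e" if "0 < e" for e
  proof -
    obtain U where U: "S \<subseteq> (\<Union>i::nat. U i)" "\<And>i. bounded (U i)" "\<And>i. diameter (U i) \<le> 1"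
      "(\<Sum>i. diam_power s (U i)) \<le> ennreal (e / 2)"
      using hausdorff_measure_zeroD[OF assms(1), of 1 "e / 2"] \<open>0 < e\<close> by auto
    \<comment> \<open>A set of diameter \<open>d\<close> lies in the interval of length
      \<open>2 * d\<close> centred at any of its points; unlike \<open>U i\<close>, this interval is
      known to be measurable.\<close>
    define V where "V i = (if U i = {} then {} else cball (SOME x. x \<in> U i) (diameter (U i)))" for i
    have UV: "U i \<subseteq> V i" for i
      using diameter_bounded_bound[OF U(2), of _ i] some_in_eq[of "U i"] by (auto simp: V_def)
    have V: "emeasure lebesgue (V i) \<le> 2 * diam_power s (U i)" for i
    proof (cases "U i = {}")
      case True
      then show ?thesis by (simp add: V_def)
    next
      case False
      define d where "d = diameter (U i)"
      have d: "0 \<le> d" "d \<le> 1" using U diameter_ge_0 by (auto simp: d_def)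
      \<comment> \<open>Powers of \<open>d\<close> in \<open>(0, 1]\<close> decrease in the
        exponent, and \<open>s \<le> 1\<close>; for \<open>d = 0\<close> both sides are 0.\<close>
      have "d \<le> d powr s"
        using d assms powr_mono'[of s 1 d] by (cases "d = 0") auto
      then have "ennreal d \<le> diam_power s (U i)"
        using False d by (auto simp: diam_power_def d_def intro: ennreal_leI)
      then have "2 * ennreal d \<le> 2 * diam_power s (U i)" by (intro mult_left_mono) auto
      moreover have "emeasure lebesgue (V i) = ennreal (2 * d)"
        using False d by (simp add: V_def d_def[symmetric] cball_eq_atLeastAtMost)
      ultimately show ?thesis using d by (simp add: ennreal_mult)
    qed
    have Vm: "V i \<in> sets lebesgue" for i by (simp add: V_def)
    have "emeasure lebesgue (\<Union>i. V i) \<le> (\<Sum>i. emeasure lebesgue (V i))"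
      using Vm by (intro emeasure_subadditive_countably) auto
    also have "\<dots> \<le> (\<Sum>i. 2 * diam_power s (U i))"
      using V by (intro suminf_le) auto
    also have "\<dots> = 2 * (\<Sum>i. diam_power s (U i))" by simp
    also have "\<dots> \<le> 2 * ennreal (e / 2)" using U(4) by (intro mult_left_mono) auto
    also have "\<dots> = ennreal (2 * (e / 2))" using \<open>0 < e\<close> by (subst ennreal_mult) auto
    finally have le: "emeasure lebesgue (\<Union>i. V i) \<le> ennreal e" by simp
    then have fm: "(\<Union>i. V i) \<in> lmeasurable"
      using Vm by (intro fmeasurableI) (auto intro: le_less_trans)
    then have "measure lebesgue (\<Union>i. V i) \<le> e"
      using le \<open>0 < e\<close> by (simp add: emeasure_eq_measure2)
    with fm U(1) UV show ?thesis by (intro exI[of _ "\<Union>i. V i"]) blast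
  qed
  then show ?thesis by (simp add: negligible_outer_le flip: negligible_iff_null_sets)
qed

lemma hausdorff_dim_zero_imp_null:
  fixes S :: "real set"
  assumes "hausdorff_dim S = 0"
  shows "S \<in> null_sets lebesgue"
proof -
  have "hausdorff_dim S < 1" using assms by simp
  then obtain s where "0 \<le> s" "hausdorff_measure s S = 0" "ennreal s < 1"
    unfolding hausdorff_dim_def Inf_less_iff by blast
  then show ?thesis by (intro hausdorff_measure_zero_imp_null[of s]) auto
qed

text \<open>A counterexample \<open>S\<close> is null yet dense in an interval. Every nonempty open
  part of that interval meets \<open>S\<close>, so the rest of the interval has no interior and is
  null as well, making the whole interval null.\<close>

lemma null_imp_i_minimal:
  assumes M: "expands_real_field M"
    and null: "\<And>S. definable M S \<Longrightarrow> interior S \<noteq> {} \<or> S \<in> null_sets lebesgue"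
  shows "i_minimal M"
  unfolding i_minimal_def
proof (intro allI impI, rule ccontr)
  fix S assume S: "definable M S" "\<not> (interior S \<noteq> {} \<or> nowhere_dense S)"
  then obtain x e where e: "e > 0" "ball x e \<subseteq> closure S"
    unfolding nowhere_dense_def by (metis ex_in_conv mem_interior)
  define T where "T = {x - e<..<x + e} - S"
  have "interior T = {}"
  proof (rule ccontr)
    assume ne: "interior T \<noteq> {}"
    have "interior T \<subseteq> closure S"
      using e(2) interior_subset[of T] by (auto simp: T_def ball_eq_greaterThanLessThan)
    then have "interior T \<inter> S \<noteq> {}"
      using ne open_Int_closure_eq_empty[OF open_interior, of T S] by blast
    then show False using interior_subset[of T] by (auto simp: T_def)
  qed
  then have "T \<in> null_sets lebesgue"
    using null definable_Ioo_Diff[OF M S(1)] unfolding T_def by blast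
  moreover have "S \<in> null_sets lebesgue" using null S by blast
  ultimately have "negligible (T \<union> S)"
    unfolding negligible_iff_null_sets by (rule null_sets.Un)
  then have "negligible {x - e<..<x + e}" by (rule negligible_subset) (auto simp: T_def)
  then show False using e(1) by (simp add: negligible_iff_null_sets null_sets_def)
qed

theorem theorem1p1:
  fixes M :: "('f, 'r, real) fo_structure"
  assumes "expands_real_field M"
  shows "(i_minimal M \<longleftrightarrow>
            (\<forall>S. definable M S \<longrightarrow> interior S \<noteq> {} \<or> S \<in> null_sets lebesgue)) \<and>
         ((\<forall>S. definable M S \<longrightarrow> interior S \<noteq> {} \<or> S \<in> null_sets lebesgue) \<longleftrightarrow>
            (\<forall>S. definable M S \<longrightarrow> interior S \<noteq> {} \<or> hausdorff_dim S = 0))"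
  (is "(_ \<longleftrightarrow> ?null) \<and> (_ \<longleftrightarrow> ?dim)")
proof -
  \<comment> \<open>The three implications close a cycle.\<close>
  have "i_minimal M" if ?null using null_imp_i_minimal[OF assms] that by blast
  moreover have ?dim if "i_minimal M" using i_minimal_imp_hausdorff_dim_zero[OF assms that] by blast
  moreover have ?null if ?dim using hausdorff_dim_zero_imp_null that by blast
  ultimately show ?thesis by argo
qed

end
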